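(* Let $n\ge 2$ be an integer and let $d=2$. Then the $(n,d)$ Delsarte linear program has a unique optimum, namely $A^*=(A_0^*,\dots,A_n^* )$ given by \[ A^*_i = \begin{cases} \binom{n}{i} & i \text{ is even} \\ 0 & i \text{ is odd}\end{cases} \] for all $0\le i\le n$.
   Context: $[a]=\{1,\dots,a\}$. $\binom{a}{b}=0$ unless $0\le b\le a$. For $0\le i,j\le n$, the Krawtchouk polynomial is $K_j(i)=K_j(i;n)=\sum_{k=0}^j(-1)^k\binom{i}{k}\binom{n-i}{j-k}$. For integers $1\le d\le n$, the $(n,d)$ Delsarte linear program, in real variables $A=(A_0,\dots,A_n)$, is: maximize $\sum_{i=0}^n A_i$ subject to $\sum_{i=0}^n A_iK_j(i)\ge 0$ for all $j\in[n]$; $A_i=0$ for all $i\in[d-1]$; $A_0=1$; $A_i\ge 0$ for all $i\in[n]$. An optimum is a feasible point achieving the optimal objective value. *)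

theory Defs
  imports Complex_Main "HOL-Library.FuncSet"
begin

(* Meant for i, j <= n only: for i > n the subtraction n - i truncates. *)
definition krawtchouk :: "nat \<Rightarrow> nat \<Rightarrow> nat \<Rightarrow> real" where
  "krawtchouk n j i =
     (\<Sum>k=0..j. (-1) ^ k * real (i choose k) * real ((n - i) choose (j - k)))"

(* A vector (A_0, ..., A_n) of reals is encoded as a function in extensional {0..n}
   (fixed to the value undefined outside the index set), so that equality of functions is
   equality of vectors. *)
definition delsarte_feasible :: "nat \<Rightarrow> nat \<Rightarrow> (nat \<Rightarrow> real) \<Rightarrow> bool" where
  "delsarte_feasible n d A \<longleftrightarrow>
     A \<in> extensional {0..n} \<and>
     (\<forall>j\<in>{1..n}. (\<Sum>i=0..n. A i * krawtchouk n j i) \<ge> 0) \<and>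
     (\<forall>i\<in>{1..d - 1}. A i = 0) \<and>
     A 0 = 1 \<and>
     (\<forall>i\<in>{1..n}. A i \<ge> 0)"

definition delsarte_objective :: "nat \<Rightarrow> (nat \<Rightarrow> real) \<Rightarrow> real" where
  "delsarte_objective n A = (\<Sum>i=0..n. A i)"

definition delsarte_optimum :: "nat \<Rightarrow> nat \<Rightarrow> (nat \<Rightarrow> real) \<Rightarrow> bool" where
  "delsarte_optimum n d A \<longleftrightarrow> is_arg_max (delsarte_objective n) (delsarte_feasible n d) A"

end

theory Submission
  imports Defs
begin

text \<open>
  Attach to a vector \<open>A\<close> its Krawtchouk transform \<open>B\<^sub>j = (\<Sum>i\<le>n. A\<^sub>i K\<^sub>j(i))\<close>. The inequalities
  of the linear program that involve Krawtchouk polynomials say \<open>B\<^sub>j \<ge> 0\<close> for \<open>1 \<le> j \<le> n\<close>, the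
  objective is \<open>B\<^sub>0\<close> because \<open>K\<^sub>0 = 1\<close>, and, since the
  Krawtchouk matrix squares to \<open>2^n\<close> times the identity (lemma \<open>krawtchouk_orthogonality\<close>),
  the transform is its own inverse up to that factor: \<open>2^n A\<^sub>l = (\<Sum>j\<le>n. B\<^sub>j K\<^sub>l(j))\<close>.

  Reading the two equations \<open>A\<^sub>0 = 1\<close> and \<open>A\<^sub>1 = 0\<close> on the transformed side, where \<open>K\<^sub>0(j) = 1\<close> and
  \<open>K\<^sub>1(j) = n - 2j\<close>, and adding \<open>n\<close> times the first to the second, gives
  \[ n 2^n = 2 n B_0 + \sum_{j=1}^{n} 2 (n - j) B_j . \]
  All terms of the last sum are nonnegative, so the objective is at most \<open>2^(n-1)\<close>. Equality
  forces \<open>B\<^sub>j = 0\<close> for \<open>0 < j < n\<close>, and then \<open>B\<^sub>0 = B\<^sub>n = 2^(n-1)\<close>. Inverting the transform, this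
  single \<open>B\<close> comes from \<open>A\<^sub>i = (K\<^sub>i(0) + K\<^sub>i(n)) / 2\<close>, which is \<open>n choose i\<close> for even \<open>i\<close> and \<open>0\<close> for
  odd \<open>i\<close>. That this vector is feasible and reaches \<open>2^(n-1)\<close> is the orthogonality once more
  (lemma \<open>transform_even_weight\<close>).
\<close>

section \<open>Krawtchouk polynomials and their orthogonality\<close>

lemma krawtchouk_0_left [simp]: "krawtchouk n 0 i = 1"
  by (simp add: krawtchouk_def)

lemma krawtchouk_1_left: "i \<le> n \<Longrightarrow> krawtchouk n 1 i = real n - 2 * real i"
  by (simp add: krawtchouk_def of_nat_diff)

lemma krawtchouk_at_0: "krawtchouk n j 0 = real (n choose j)"
proof -
  have "krawtchouk n j 0 = (\<Sum>k=0..j. if k = 0 then real (n choose j) else 0)"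
    unfolding krawtchouk_def by (rule sum.cong) auto
  then show ?thesis by simp
qed

lemma krawtchouk_at_n: "krawtchouk n j n = (-1) ^ j * real (n choose j)"
proof -
  have "krawtchouk n j n = (\<Sum>k=0..j. if k = j then (-1) ^ j * real (n choose j) else 0)"
    unfolding krawtchouk_def by (rule sum.cong) auto
  then show ?thesis by simp
qed

text \<open>
  The definition of \<open>K\<^sub>j(i)\<close> is a Cauchy product, of the coefficients of \<open>(y - x)^i\<close> with those of
  \<open>(y + x)^(n - i)\<close>. The homogeneous form, with \<open>y\<close> free, allows the substitution
  \<open>x = 1 - z\<close>, \<open>y = 1 + z\<close> in the proof of orthogonality.
\<close>

lemma krawtchouk_generating_function:
  fixes x y :: real
  assumes "i \<le> n"
  shows "(\<Sum>j\<le>n. krawtchouk n j i * x ^ j * y ^ (n - j)) = (y - x) ^ i * (y + x) ^ (n - i)"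
proof -
  define a where "a k = (-1) ^ k * real (i choose k) * y ^ (i - k)" for k
  define b where "b k = real ((n - i) choose k) * y ^ (n - i - k)" for k
  have a: "(y - x) ^ i = (\<Sum>k\<le>i. a k * x ^ k)"
  proof -
    have "(- x + y) ^ i = (\<Sum>k\<le>i. a k * x ^ k)"
      unfolding binomial_ring a_def
      by (rule sum.cong) (auto simp: power_minus[of x] mult_ac)
    then show ?thesis by simp
  qed
  have b: "(y + x) ^ (n - i) = (\<Sum>k\<le>n - i. b k * x ^ k)"
  proof -
    have "(x + y) ^ (n - i) = (\<Sum>k\<le>n - i. b k * x ^ k)"
      unfolding binomial_ring b_def by (rule sum.cong) (auto simp: mult_ac)
    then show ?thesis by (simp add: add.commute)
  qed
  have coeff: "(\<Sum>k\<le>j. a k * b (j - k)) = krawtchouk n j i * y ^ (n - j)" if "j \<le> n" for j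
  proof -
    have "a k * b (j - k) =
        (-1) ^ k * real (i choose k) * real ((n - i) choose (j - k)) * y ^ (n - j)"
      if "k \<le> j" for k
    proof (cases "k \<le> i \<and> j - k \<le> n - i")
      case True
      then have "i - k + (n - i - (j - k)) = n - j"
        using assms \<open>j \<le> n\<close> \<open>k \<le> j\<close> by linarith
      then show ?thesis
        by (simp add: a_def b_def mult_ac flip: power_add)
    next
      case False
      then show ?thesis by (auto simp: a_def b_def)
    qed
    then show ?thesis
      by (simp add: krawtchouk_def sum_distrib_right atLeast0AtMost)
  qed
  have "(y - x) ^ i * (y + x) ^ (n - i) =
      (\<Sum>j\<le>i + (n - i). (\<Sum>k\<le>j. a k * b (j - k)) * x ^ j)"
    unfolding a b by (rule polynomial_product) (auto simp: a_def b_def)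
  also have "\<dots> = (\<Sum>j\<le>n. krawtchouk n j i * x ^ j * y ^ (n - j))"
    using assms by (intro sum.cong) (auto simp: coeff)
  finally show ?thesis by simp
qed

text \<open>
  Both sides are coefficients at \<open>z^l\<close> of one polynomial: applying the generating function to the
  index \<open>l\<close> and then to \<open>j\<close> sums the left side to \<open>(2z)^i 2^(n - i) = 2^n z^i\<close>.
\<close>

lemma krawtchouk_orthogonality:
  assumes "i \<le> n" and "l \<le> n"
  shows "(\<Sum>j\<le>n. krawtchouk n j i * krawtchouk n l j) = (if l = i then 2 ^ n else 0)"
proof -
  define c where "c l = (\<Sum>j\<le>n. krawtchouk n j i * krawtchouk n l j)" for l
  have "(\<Sum>l\<le>n. c l * z ^ l) = (\<Sum>l\<le>n. (if l = i then 2 ^ n else 0) * z ^ l)" for z :: real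
  proof -
    have "(\<Sum>l\<le>n. c l * z ^ l) =
        (\<Sum>l\<le>n. \<Sum>j\<le>n. krawtchouk n j i * (krawtchouk n l j * z ^ l * 1 ^ (n - l)))"
      by (simp add: c_def sum_distrib_left mult_ac)
    also have "\<dots> = (\<Sum>j\<le>n. krawtchouk n j i * (\<Sum>l\<le>n. krawtchouk n l j * z ^ l * 1 ^ (n - l)))"
      by (subst sum.swap) (simp add: sum_distrib_left)
    also have "\<dots> = (\<Sum>j\<le>n. krawtchouk n j i * (1 - z) ^ j * (1 + z) ^ (n - j))"
      by (rule sum.cong) (auto simp: krawtchouk_generating_function simp del: power_one)
    also have "\<dots> = (1 + z - (1 - z)) ^ i * (1 + z + (1 - z)) ^ (n - i)"
      by (rule krawtchouk_generating_function) fact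
    also have "\<dots> = 2 ^ i * 2 ^ (n - i) * z ^ i"
      by (simp add: power_mult_distrib flip: mult_2)
    also have "2 ^ i * 2 ^ (n - i) = (2 ^ n :: real)"
      using \<open>i \<le> n\<close> by (simp flip: power_add)
    also have "2 ^ n * z ^ i = (\<Sum>l\<le>n. if l = i then 2 ^ n * z ^ i else 0)"
      using \<open>i \<le> n\<close> by simp
    also have "\<dots> = (\<Sum>l\<le>n. (if l = i then 2 ^ n else 0) * z ^ l)"
      by (rule sum.cong) auto
    finally show ?thesis .
  qed
  then have "\<forall>l\<le>n. c l = (if l = i then 2 ^ n else 0)"
    by (subst polyfun_eq_coeffs[symmetric]) simp
  with \<open>l \<le> n\<close> show ?thesis by (simp add: c_def)
qed

section \<open>The Krawtchouk transform\<close>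

definition krawtchouk_transform :: "nat \<Rightarrow> (nat \<Rightarrow> real) \<Rightarrow> nat \<Rightarrow> real" where
  "krawtchouk_transform n A j = (\<Sum>i\<le>n. A i * krawtchouk n j i)"

lemma krawtchouk_transform_inversion:
  assumes "l \<le> n"
  shows "krawtchouk_transform n (krawtchouk_transform n A) l = 2 ^ n * A l"
proof -
  have "krawtchouk_transform n (krawtchouk_transform n A) l =
      (\<Sum>j\<le>n. \<Sum>i\<le>n. A i * (krawtchouk n j i * krawtchouk n l j))"
    by (simp add: krawtchouk_transform_def sum_distrib_left mult_ac)
  also have "\<dots> = (\<Sum>i\<le>n. A i * (\<Sum>j\<le>n. krawtchouk n j i * krawtchouk n l j))"
    by (subst sum.swap) (simp add: sum_distrib_left)
  also have "\<dots> = (\<Sum>i\<le>n. if i = l then 2 ^ n * A l else 0)"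
    using \<open>l \<le> n\<close> by (intro sum.cong) (auto simp: krawtchouk_orthogonality)
  finally show ?thesis using \<open>l \<le> n\<close> by simp
qed

lemma delsarte_objective_eq_transform: "delsarte_objective n A = krawtchouk_transform n A 0"
  by (simp add: delsarte_objective_def krawtchouk_transform_def atLeast0AtMost)

lemma delsarte_feasible_transform_nonneg:
  "delsarte_feasible n d A \<Longrightarrow> j \<in> {1..n} \<Longrightarrow> krawtchouk_transform n A j \<ge> 0"
  by (simp add: delsarte_feasible_def krawtchouk_transform_def atLeast0AtMost)

section \<open>The bound on the objective and its equality case\<close>

text \<open>
  This is the certificate of optimality: the combination of the constraints \<open>A\<^sub>0 = 1\<close> and
  \<open>A\<^sub>1 = 0\<close> whose weights \<open>n + K\<^sub>1(j) = 2 (n - j)\<close> on the transformed side are nonnegative and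
  vanish only at \<open>j = n\<close>.
\<close>

lemma delsarte_slack_identity:
  assumes "n \<ge> 1" and "A 0 = 1" and "A 1 = 0"
  shows "real n * (2 ^ n - 2 * krawtchouk_transform n A 0) =
    (\<Sum>j=1..n. 2 * real (n - j) * krawtchouk_transform n A j)"
proof -
  let ?B = "krawtchouk_transform n A"
  have "real n * 2 ^ n = real n * krawtchouk_transform n ?B 0 + krawtchouk_transform n ?B 1"
    using assms by (simp add: krawtchouk_transform_inversion)
  also have "\<dots> = (\<Sum>j\<le>n. real n * (?B j * krawtchouk n 0 j) + ?B j * krawtchouk n 1 j)"
    unfolding krawtchouk_transform_def[of n ?B] by (simp only: sum_distrib_left sum.distrib)
  also have "\<dots> = (\<Sum>j=0..n. 2 * real (n - j) * ?B j)"
    unfolding atLeast0AtMost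
    by (rule sum.cong)
      (auto simp: krawtchouk_1_left[unfolded One_nat_def] of_nat_diff algebra_simps)
  also have "\<dots> = 2 * real n * ?B 0 + (\<Sum>j=1..n. 2 * real (n - j) * ?B j)"
    by (simp add: sum.atLeast_Suc_atMost)
  finally show ?thesis by (simp add: algebra_simps)
qed

lemma delsarte_2_objective_le:
  assumes "n \<ge> 1" and "delsarte_feasible n 2 A"
  shows "2 * delsarte_objective n A \<le> 2 ^ n"
proof -
  have "A 0 = 1" "A 1 = 0"
    using assms by (auto simp: delsarte_feasible_def)
  then have "real n * (2 ^ n - 2 * krawtchouk_transform n A 0) \<ge> 0"
    unfolding delsarte_slack_identity[OF \<open>n \<ge> 1\<close> \<open>A 0 = 1\<close> \<open>A 1 = 0\<close>]
    by (intro sum_nonneg mult_nonneg_nonneg delsarte_feasible_transform_nonneg[OF assms(2)]) auto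
  then show ?thesis
    using \<open>n \<ge> 1\<close> by (simp add: zero_le_mult_iff delsarte_objective_eq_transform)
qed

text \<open>
  Equality in the bound kills every transformed coordinate of positive weight in the slack
  identity. The two remaining ones, at \<open>0\<close> and \<open>n\<close>, are equal because
  \<open>B\<^sub>0 + B\<^sub>n = 2^n A\<^sub>0 = 2^n\<close>, so the inversion formula determines \<open>A\<close>.
\<close>

lemma delsarte_2_tight_eq:
  assumes "n \<ge> 1" and feas: "delsarte_feasible n 2 A"
    and tight: "2 * delsarte_objective n A = 2 ^ n" and "i \<le> n"
  shows "A i = (if even i then real (n choose i) else 0)"
proof -
  let ?B = "krawtchouk_transform n A"
  have A: "A 0 = 1" "A 1 = 0"
    using assms by (auto simp: delsarte_feasible_def)
  have B0: "?B 0 = 2 ^ n / 2"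
    using tight by (simp add: delsarte_objective_eq_transform)
  have "(\<Sum>j=1..n. 2 * real (n - j) * ?B j) = 0"
    using delsarte_slack_identity[OF \<open>n \<ge> 1\<close> A] B0 by simp
  then have "\<forall>j\<in>{1..n}. 2 * real (n - j) * ?B j = 0"
    by (subst (asm) sum_nonneg_eq_0_iff)
      (auto intro!: mult_nonneg_nonneg delsarte_feasible_transform_nonneg[OF feas])
  then have mid: "?B j = 0" if "j \<noteq> 0" "j \<noteq> n" "j \<le> n" for j
    using that by auto
  have inv: "2 ^ n * A l = ?B 0 * krawtchouk n l 0 + ?B n * krawtchouk n l n" if "l \<le> n" for l
  proof -
    have "2 ^ n * A l = (\<Sum>j\<le>n. ?B j * krawtchouk n l j)"
      using krawtchouk_transform_inversion[OF that, of A]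
      by (simp add: krawtchouk_transform_def[of n ?B])
    also have "\<dots> = (\<Sum>j\<in>{0, n}. ?B j * krawtchouk n l j)"
      by (rule sum.mono_neutral_right) (auto simp: mid)
    finally show ?thesis using \<open>n \<ge> 1\<close> by simp
  qed
  have Bn: "?B n = 2 ^ n / 2"
    using inv[of 0] A B0 by simp
  have "2 ^ n * A i = 2 ^ n * (if even i then real (n choose i) else 0)"
    unfolding inv[OF \<open>i \<le> n\<close>] B0 Bn krawtchouk_at_0 krawtchouk_at_n by simp
  then show ?thesis by simp
qed

section \<open>The optimum for minimum distance two\<close>

text \<open>
  The entry at \<open>i\<close> is \<open>(K\<^sub>i(0) + K\<^sub>i(n)) / 2\<close>, so orthogonality evaluates the transform.
\<close>

lemma transform_even_weight:
  assumes "j \<le> n"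
  shows "krawtchouk_transform n (\<lambda>i\<in>{0..n}. if even i then real (n choose i) else 0) j =
    ((if j = 0 then 2 ^ n else 0) + (if j = n then 2 ^ n else 0)) / 2"
proof -
  have "krawtchouk_transform n (\<lambda>i\<in>{0..n}. if even i then real (n choose i) else 0) j =
      (\<Sum>i\<le>n. (krawtchouk n i 0 * krawtchouk n j i + krawtchouk n i n * krawtchouk n j i) / 2)"
    unfolding krawtchouk_transform_def
    by (rule sum.cong) (auto simp: krawtchouk_at_0 krawtchouk_at_n)
  then show ?thesis
    using assms
    by (simp add: sum.distrib krawtchouk_orthogonality flip: sum_divide_distrib)
qed

lemma even_weight_delsarte_feasible:
  assumes "n \<ge> 1"
  shows "delsarte_feasible n 2 (\<lambda>i\<in>{0..n}. if even i then real (n choose i) else 0)"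
    (is "delsarte_feasible n 2 ?E")
proof -
  have "(\<Sum>i=0..n. ?E i * krawtchouk n j i) \<ge> 0" if "j \<in> {1..n}" for j
  proof -
    have "krawtchouk_transform n ?E j \<ge> 0"
      using that by (subst transform_even_weight) auto
    then show ?thesis
      by (simp only: krawtchouk_transform_def atLeast0AtMost)
  qed
  moreover have "?E i = 0" if "i \<in> {1..2 - 1}" for i
    using assms that by auto
  ultimately show ?thesis
    by (simp add: delsarte_feasible_def)
qed

theorem theorem3p7:
  fixes n d :: nat
  assumes "n \<ge> 2" and "d = 2"
  shows "{A. delsarte_optimum n d A} =
           {\<lambda>i\<in>{0..n}. if even i then real (n choose i) else 0}"
proof -
  let ?E = "\<lambda>i\<in>{0..n}. if even i then real (n choose i) else 0"
  have n: "n \<ge> 1" using assms by simp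
  have feas: "delsarte_feasible n 2 ?E"
    using n by (rule even_weight_delsarte_feasible)
  have obj: "2 * delsarte_objective n ?E = 2 ^ n"
    using n by (simp add: delsarte_objective_eq_transform transform_even_weight)
  have "A = ?E" if opt: "delsarte_optimum n 2 A" for A
  proof -
    have A: "delsarte_feasible n 2 A" "delsarte_objective n ?E \<le> delsarte_objective n A"
      using opt feas by (auto simp: delsarte_optimum_def is_arg_max_def not_less)
    have "2 * delsarte_objective n A = 2 ^ n"
      using delsarte_2_objective_le[OF n A(1)] A(2) obj by linarith
    then have "A i = ?E i" if "i \<in> {0..n}" for i
      using delsarte_2_tight_eq[OF n A(1)] that by simp
    moreover have "A \<in> extensional {0..n}"
      using A(1) by (simp add: delsarte_feasible_def)
    ultimately show ?thesis
      by (intro extensionalityI[of _ "{0..n}"]) auto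
  qed
  moreover have "delsarte_optimum n 2 ?E"
    unfolding delsarte_optimum_def is_arg_max_def
    using feas delsarte_2_objective_le[OF n] obj by force
  ultimately show ?thesis
    unfolding \<open>d = 2\<close> by blast
qed

end
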